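(* Let $\psi:\mathbb{R}^n\to\mathbb{R}$ be $C^1$, let $w\in\mathbb{R}^n$, and let $w^*$ be any stationary point of $\psi$. For any constant $r>\|w-w^*\|$ and any $\epsilon>0$, $\psi$ satisfies the $(w,w^*,r,\rho,\epsilon)$-dissipative condition near $w$ for some dissipativity constant $\rho$ satisfying $$\rho\le\frac{r}{\epsilon}.$$
   Context: $B_{w^*}(r)$ is the open Euclidean ball of radius $r$ centered at $w^*$. A function $\psi\in C^1$ satisfies the $(w,w^*,r,\rho,\epsilon)$-dissipative condition near $w$ if $w^*$ is a stationary point, $r>\|w-w^*\|$, and for all $\tilde w\in B_{w^*}(r)\setminus\{v:\|\nabla\psi(v)\|\le\epsilon\}$, $$\nabla\psi(\tilde w)^\top(\tilde w-w^* )\ge-\rho\|\nabla\psi(\tilde w)\|^2,$$ where $\epsilon>0$ and $\rho\in\mathbb{R}$ is a constant that may depend on $w,w^*,\epsilon$ but not on $\tilde w$. *)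

theory Defs
  imports "HOL-Analysis.Analysis"
begin

text \<open>Only meaningful where \<open>f\<close> is differentiable; see \<open>GDERIV_gradient\<close>.\<close>

definition gradient :: "('a::euclidean_space \<Rightarrow> real) \<Rightarrow> 'a \<Rightarrow> 'a" where
  "gradient f x = (THE g. GDERIV f x :> g)"

lemma gradient_eqI:
  fixes f :: "'a::euclidean_space \<Rightarrow> real"
  assumes "GDERIV f x :> g"
  shows "gradient f x = g"
  unfolding gradient_def
proof (rule the_equality)
  show "GDERIV f x :> g" by fact
  fix h assume "GDERIV f x :> h"
  with assms have "(\<lambda>y. y \<bullet> h) = (\<lambda>y. y \<bullet> g)"
    unfolding gderiv_def by (rule has_derivative_unique[rotated])
  then show "h = g" by (metis vector_eq_ldot)
qed

lemma GDERIV_gradient: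
  fixes f :: "'a::euclidean_space \<Rightarrow> real"
  assumes "f differentiable (at x)"
  shows "GDERIV f x :> gradient f x"
proof -
  obtain D where D: "(f has_derivative D) (at x)"
    using assms unfolding differentiable_def by blast
  then interpret linear D by (rule has_derivative_linear)
  define g where "g = (\<Sum>b\<in>Basis. D b *\<^sub>R b)"
  have "D y = y \<bullet> g" for y
  proof -
    have "D y = D (\<Sum>b\<in>Basis. (y \<bullet> b) *\<^sub>R b)" by (simp add: euclidean_representation)
    also have "\<dots> = y \<bullet> g" 
      by (simp add: sum scale g_def inner_sum_right mult.commute)
    finally show ?thesis .
  qed
  then have "D = (\<lambda>y. y \<bullet> g)" by (rule ext)
  with D have "GDERIV f x :> g" unfolding gderiv_def by simp
  with gradient_eqI show ?thesis by metis
qed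

definition C1 :: "('a::euclidean_space \<Rightarrow> real) \<Rightarrow> bool" where
  "C1 f \<longleftrightarrow> (\<forall>x. f differentiable (at x)) \<and> continuous_on UNIV (gradient f)"

definition stationary_point :: "('a::euclidean_space \<Rightarrow> real) \<Rightarrow> 'a \<Rightarrow> bool" where
  "stationary_point f x \<longleftrightarrow> f differentiable (at x) \<and> gradient f x = 0"

definition dissipative ::
    "('a::euclidean_space \<Rightarrow> real) \<Rightarrow> 'a \<Rightarrow> 'a \<Rightarrow> real \<Rightarrow> real \<Rightarrow> real \<Rightarrow> bool" where
  "dissipative \<psi> w wstar r \<rho> \<epsilon> \<longleftrightarrow>
     C1 \<psi> \<and> \<epsilon> > 0 \<and> stationary_point \<psi> wstar \<and> r > norm (w - wstar) \<and>
     (\<forall>v \<in> ball wstar r - {v. norm (gradient \<psi> v) \<le> \<epsilon>}.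
        gradient \<psi> v \<bullet> (v - wstar) \<ge> - \<rho> * (norm (gradient \<psi> v))\<^sup>2)"

end

theory Submission
  imports Defs
begin

text \<open>The bound \<open>r / \<epsilon>\<close> itself serves as \<open>\<rho>\<close>. By
  Cauchy-Schwarz, inside the ball the inner product is at least \<open>- r\<close> times the
  gradient norm. This is linear in the norm, while dissipativity asks for a quadratic bound; where
  the norm exceeds \<open>\<epsilon>\<close>, it is at most its square divided by
  \<open>\<epsilon>\<close>, which closes the gap.\<close>

theorem proposition2:
  fixes \<psi> :: "real ^ 'n \<Rightarrow> real" and w wstar :: "real ^ 'n" and r \<epsilon> :: real
  assumes "C1 \<psi>"
    and "stationary_point \<psi> wstar"
    and "r > norm (w - wstar)"
    and "\<epsilon> > 0"
  shows "\<exists>\<rho>. \<rho> \<le> r / \<epsilon> \<and> dissipative \<psi> w wstar r \<rho> \<epsilon>"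
proof -
  \<comment> \<open>Makes the factor \<open>r / \<epsilon>\<close> nonnegative, as the last estimate
    of the chain requires.\<close>
  have r: "r > 0"
    using assms(3) norm_ge_zero le_less_trans by blast
  have "gradient \<psi> v \<bullet> (v - wstar) \<ge> - (r / \<epsilon>) * (norm (gradient \<psi> v))\<^sup>2"
    if v: "v \<in> ball wstar r - {v. norm (gradient \<psi> v) \<le> \<epsilon>}" for v
  proof -
    let ?g = "norm (gradient \<psi> v)"
    have dist: "norm (v - wstar) \<le> r" and g: "\<epsilon> \<le> ?g"
      using v by (auto simp: dist_norm norm_minus_commute)
    have "- (gradient \<psi> v \<bullet> (v - wstar)) \<le> ?g * norm (v - wstar)"
      using Cauchy_Schwarz_ineq2[of "gradient \<psi> v" "v - wstar"] by linarith
    also have "\<dots> \<le> ?g * r"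
      using dist by (simp add: mult_left_mono)
    \<comment> \<open>Splitting off a factor \<open>\<epsilon>\<close> lets the lower bound
      \<open>\<epsilon> \<le> ?g\<close> turn \<open>\<epsilon> * ?g\<close> into
      \<open>?g\<^sup>2\<close>; this is where the exclusion of small gradients enters.\<close>
    also have "\<dots> = (r / \<epsilon>) * (\<epsilon> * ?g)"
      using \<open>\<epsilon> > 0\<close> by simp
    also have "\<dots> \<le> (r / \<epsilon>) * ?g\<^sup>2"
      unfolding power2_eq_square
      using g r \<open>\<epsilon> > 0\<close> by (intro mult_left_mono mult_right_mono) auto
    finally show ?thesis by simp
  qed
  then have "dissipative \<psi> w wstar r (r / \<epsilon>) \<epsilon>"
    using assms unfolding dissipative_def by blast
  then show ?thesis by blast
qed

end
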